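(* Let $(X,d_1)$ and $(Y,d_2)$ be two metric spaces, and let $(X,f_{1,\infty})$ and $(Y,g_{1,\infty})$ be non-autonomous systems. Then $(X,f_{1,\infty})$ and $(Y,g_{1,\infty})$ both have the strong specification property (SSP) if and only if the non-autonomous system $(X\times Y,f_{1,\infty}\times g_{1,\infty})$ has SSP.
   Context: A non-autonomous (discrete) system $(X,f_{1,\infty})$ consists of a compact metric space $(X,d)$ and a sequence $f_{1,\infty}=(f_n)_{n\ge 1}$ of continuous surjective maps $f_n:X\to X$ (so both metric spaces in the claim are compact). Write $\mathbb{N}=\{1,2,\dots\}$, $f_1^0=\mathrm{id}$ and $f_1^n=f_n\circ\cdots\circ f_1$ for $n\ge1$. The product system $f_{1,\infty}\times g_{1,\infty}$ on $X\times Y$ is the sequence $(f_n\times g_n)_{n\ge1}$, where $X\times Y$ carries the metric $\tilde d((x_1,y_1),(x_2,y_2))=\max\{d_1(x_1,x_2),d_2(y_1,y_2)\}$. A point $z$ is periodic with period $p\in\mathbb{N}$ if $f_1^{pm}(z)=z$ for every $m\in\mathbb{N}$ ($p$ need not be minimal). $(X,f_{1,\infty})$ has the strong specification property (SSP) if for every $\epsilon>0$ there is a positive integer $M(\epsilon)$ such that for every $s\in\mathbb{N}$, every choice of points $x_1,\dots,x_s\in X$, every sequence $a_1\le b_1<a_2\le b_2<\cdots<a_s\le b_s$ of non-negative integers with $a_j-b_{j-1}>M(\epsilon)$ for $2\le j\le s$, and every integer $p>M(\epsilon)+b_s-a_1$, there is a periodic point $z\in X$ with period $p$ such that $d(f_1^j(z),f_1^j(x_i))<\epsilon$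 for all $a_i\le j\le b_i$, $1\le i\le s$. *)

theory Defs
  imports "HOL-Analysis.Abstract_Metric_Spaces"
begin

text \<open>The maps of a system are indexed from 1; the value \<open>f 0\<close> is never used. The carrier is
  nonempty, as is customary for a phase space (otherwise the empty system would have SSP vacuously,
  and so would its product with any other system).\<close>

definition nonautonomous_system ::
    "'a set \<Rightarrow> ('a \<Rightarrow> 'a \<Rightarrow> real) \<Rightarrow> (nat \<Rightarrow> 'a \<Rightarrow> 'a) \<Rightarrow> bool" where
  "nonautonomous_system X d f \<longleftrightarrow>
     Metric_space X d \<and> X \<noteq> {} \<and> compact_space (Metric_space.mtopology X d) \<and>
     (\<forall>n\<ge>1. continuous_map (Metric_space.mtopology X d) (Metric_space.mtopology X d) (f n) \<and>
            f n ` X = X)"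

text \<open>\<open>iter f n\<close> is the composition \<open>f n \<circ> \<dots> \<circ> f 1\<close>.\<close>

primrec iter :: "(nat \<Rightarrow> 'a \<Rightarrow> 'a) \<Rightarrow> nat \<Rightarrow> 'a \<Rightarrow> 'a" where
  "iter f 0 = id"
| "iter f (Suc n) = f (Suc n) \<circ> iter f n"

text \<open>The period need not be minimal.\<close>

definition periodic_point :: "'a set \<Rightarrow> (nat \<Rightarrow> 'a \<Rightarrow> 'a) \<Rightarrow> nat \<Rightarrow> 'a \<Rightarrow> bool" where
  "periodic_point X f p z \<longleftrightarrow> z \<in> X \<and> p \<ge> 1 \<and> (\<forall>m\<ge>1. iter f (p * m) z = z)"

text \<open>The points and the interval endpoints are given as functions on \<open>nat\<close>, of which only the
  values at \<open>1, \<dots>, s\<close> matter. The differences are taken in \<open>int\<close> to avoid truncation. Letting \<open>p\<close>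
  range over \<open>nat\<close> is no restriction, since the lower bound on \<open>p\<close> is positive.\<close>

definition SSP :: "'a set \<Rightarrow> ('a \<Rightarrow> 'a \<Rightarrow> real) \<Rightarrow> (nat \<Rightarrow> 'a \<Rightarrow> 'a) \<Rightarrow> bool" where
  "SSP X d f \<longleftrightarrow>
     (\<forall>\<epsilon>>0. \<exists>M::nat. M > 0 \<and>
       (\<forall>s\<ge>1. \<forall>(x :: nat \<Rightarrow> 'a) (a :: nat \<Rightarrow> nat) (b :: nat \<Rightarrow> nat) (p :: nat).
         (\<forall>i\<in>{1..s}. x i \<in> X) \<longrightarrow>
         (\<forall>i\<in>{1..s}. a i \<le> b i) \<longrightarrow>
         (\<forall>j\<in>{2..s}. b (j - 1) < a j) \<longrightarrow>
         (\<forall>j\<in>{2..s}. int (a j) - int (b (j - 1)) > int M) \<longrightarrow>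
         int p > int M + int (b s) - int (a 1) \<longrightarrow>
         (\<exists>z. periodic_point X f p z \<and>
              (\<forall>i\<in>{1..s}. \<forall>j\<in>{a i..b i}. d (iter f j z) (iter f j (x i)) < \<epsilon>))))"

text \<open>The library's product metric is the Euclidean one, so the maximum metric is defined here.\<close>

definition max_dist ::
    "('a \<Rightarrow> 'a \<Rightarrow> real) \<Rightarrow> ('b \<Rightarrow> 'b \<Rightarrow> real) \<Rightarrow> 'a \<times> 'b \<Rightarrow> 'a \<times> 'b \<Rightarrow> real" where
  "max_dist d1 d2 = (\<lambda>(x1, y1) (x2, y2). max (d1 x1 x2) (d2 y1 y2))"

definition prod_system ::
    "(nat \<Rightarrow> 'a \<Rightarrow> 'a) \<Rightarrow> (nat \<Rightarrow> 'b \<Rightarrow> 'b) \<Rightarrow> nat \<Rightarrow> 'a \<times> 'b \<Rightarrow> 'a \<times> 'b" where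
  "prod_system f g = (\<lambda>n. map_prod (f n) (g n))"

lemma max_dist_apply: "max_dist d1 d2 (x1, y1) (x2, y2) = max (d1 x1 x2) (d2 y1 y2)"
  by (simp add: max_dist_def)

lemma Metric_space_max_dist:
  assumes "Metric_space X d1" "Metric_space Y d2"
  shows "Metric_space (X \<times> Y) (max_dist d1 d2)"
proof -
  interpret A: Metric_space X d1 by fact
  interpret B: Metric_space Y d2 by fact
  show ?thesis
  proof
    fix u v w
    show "0 \<le> max_dist d1 d2 u v"
      by (auto simp: max_dist_def split: prod.splits intro: max.coboundedI1)
    show "max_dist d1 d2 u v = max_dist d1 d2 v u"
      by (auto simp: max_dist_def A.commute B.commute split: prod.splits)
    assume uv: "u \<in> X \<times> Y" "v \<in> X \<times> Y"
    then obtain u1 u2 v1 v2 where [simp]: "u = (u1, u2)" "v = (v1, v2)"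
      and m: "u1 \<in> X" "v1 \<in> X" "u2 \<in> Y" "v2 \<in> Y"
      by auto
    show "max_dist d1 d2 u v = 0 \<longleftrightarrow> u = v"
      using m A.nonneg[of u1 v1] B.nonneg[of u2 v2] A.zero[of u1 v1] B.zero[of u2 v2]
      unfolding \<open>u = (u1, u2)\<close> \<open>v = (v1, v2)\<close> max_dist_def prod.case prod.inject by linarith
    assume "w \<in> X \<times> Y"
    then obtain w1 w2 where [simp]: "w = (w1, w2)" and mw: "w1 \<in> X" "w2 \<in> Y"
      by auto
    show "max_dist d1 d2 u w \<le> max_dist d1 d2 u v + max_dist d1 d2 v w"
      using A.triangle[of u1 v1 w1] B.triangle[of u2 v2 w2] m mw
      by (simp add: max_dist_def) linarith
  qed
qed

lemma mtopology_max_dist: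
  assumes "Metric_space X d1" "Metric_space Y d2"
  shows "Metric_space.mtopology (X \<times> Y) (max_dist d1 d2) =
         prod_topology (Metric_space.mtopology X d1) (Metric_space.mtopology Y d2)"
proof -
  interpret A: Metric_space X d1 by fact
  interpret B: Metric_space Y d2 by fact
  interpret P: Metric_space "X \<times> Y" "max_dist d1 d2"
    by (rule Metric_space_max_dist) fact+
  have ball: "P.mball (x, y) r = A.mball x r \<times> B.mball y r" for x y r
    by (auto simp: P.in_mball A.in_mball B.in_mball max_dist_apply)
  show ?thesis
  proof (rule topology_eq[THEN iffD2], intro allI iffI)
    fix S assume S: "openin P.mtopology S"
    show "openin (prod_topology A.mtopology B.mtopology) S"
      unfolding openin_prod_topology_alt
    proof (intro allI impI)
      fix x y assume xy: "(x, y) \<in> S"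
      then obtain r where r: "r > 0" "P.mball (x, y) r \<subseteq> S" and "(x, y) \<in> X \<times> Y"
        using S P.openin_mtopology by blast
      then show "\<exists>U V. openin A.mtopology U \<and> openin B.mtopology V \<and> x \<in> U \<and> y \<in> V \<and> U \<times> V \<subseteq> S"
        by (intro exI[of _ "A.mball x r"] exI[of _ "B.mball y r"]) (auto simp: ball)
    qed
  next
    fix S assume S: "openin (prod_topology A.mtopology B.mtopology) S"
    have "S \<subseteq> X \<times> Y"
      using openin_subset[OF S] by simp
    moreover have "\<exists>r>0. P.mball z r \<subseteq> S" if "z \<in> S" for z
    proof -
      obtain x y where [simp]: "z = (x, y)" by (cases z)
      obtain U V where UV: "openin A.mtopology U" "openin B.mtopology V" "x \<in> U" "y \<in> V" "U \<times> V \<subseteq> S"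
        using S \<open>z \<in> S\<close> unfolding openin_prod_topology_alt by auto metis
      obtain r where r: "r > 0" "A.mball x r \<subseteq> U"
        using UV A.openin_mtopology by blast
      obtain t where t: "t > 0" "B.mball y t \<subseteq> V"
        using UV B.openin_mtopology by blast
      have "P.mball z (min r t) \<subseteq> U \<times> V"
        using r t A.mball_subset_concentric[of "min r t" r x] B.mball_subset_concentric[of "min r t" t y]
        by (auto simp: ball)
      then show ?thesis
        using r t UV by (intro exI[of _ "min r t"]) auto
    qed
    ultimately show "openin P.mtopology S"
      unfolding P.openin_mtopology by blast
  qed
qed

lemma nonautonomous_system_prod:
  assumes "nonautonomous_system X d1 f" "nonautonomous_system Y d2 g"
  shows "nonautonomous_system (X \<times> Y) (max_dist d1 d2) (prod_system f g)"
proof -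
  have M: "Metric_space X d1" "Metric_space Y d2"
    using assms by (auto simp: nonautonomous_system_def)
  have "map_prod (f n) (g n) ` (X \<times> Y) = X \<times> Y" if "n \<ge> 1" for n
    by (rule map_prod_surj_on) (use assms that in \<open>simp_all add: nonautonomous_system_def\<close>)
  moreover have "map_prod (f n) (g n) = (\<lambda>(x, y). (f n x, g n y))" for n
    by (simp add: map_prod_def)
  ultimately show ?thesis
    using assms M
    by (auto simp: nonautonomous_system_def prod_system_def mtopology_max_dist Metric_space_max_dist
        compact_space_prod_topology continuous_map_prod_top)
qed

end

theory Submission
  imports Defs
begin

text \<open>Orbits in the product are computed coordinatewise, and a pair is \<epsilon>-close in the
  maximum metric exactly when both coordinates are. If both factors have SSP, take the larger of
  their two gaps for \<epsilon>, trace the two coordinate specifications separately with the same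
  prescribed period \<open>p\<close>, and pair the tracing points (\<open>spec_gap_prod\<close>,
  with \<open>spec_gap_mono\<close> to share the gap). Conversely, each projection is a
  non-expansive surjection that commutes with the dynamics, and SSP passes to the image of such a
  map (\<open>SSP_factor\<close>).\<close>

text \<open>Fixing \<epsilon> and \<open>M\<close> separates the tracing property from the
  quantifiers of SSP, so that gaps of different systems can be compared and enlarged.\<close>

definition spec_gap ::
    "'a set \<Rightarrow> ('a \<Rightarrow> 'a \<Rightarrow> real) \<Rightarrow> (nat \<Rightarrow> 'a \<Rightarrow> 'a) \<Rightarrow> real \<Rightarrow> nat \<Rightarrow> bool" where
  "spec_gap X d f \<epsilon> M \<longleftrightarrow>
     (\<forall>s\<ge>1. \<forall>(x :: nat \<Rightarrow> 'a) (a :: nat \<Rightarrow> nat) (b :: nat \<Rightarrow> nat) (p :: nat).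
       (\<forall>i\<in>{1..s}. x i \<in> X) \<longrightarrow> (\<forall>i\<in>{1..s}. a i \<le> b i) \<longrightarrow>
       (\<forall>j\<in>{2..s}. b (j - 1) < a j) \<longrightarrow>
       (\<forall>j\<in>{2..s}. int (a j) - int (b (j - 1)) > int M) \<longrightarrow>
       int p > int M + int (b s) - int (a 1) \<longrightarrow>
       (\<exists>z. periodic_point X f p z \<and>
            (\<forall>i\<in>{1..s}. \<forall>j\<in>{a i..b i}. d (iter f j z) (iter f j (x i)) < \<epsilon>)))"

lemma SSP_iff_spec_gap: "SSP X d f \<longleftrightarrow> (\<forall>\<epsilon>>0. \<exists>M>0. spec_gap X d f \<epsilon> M)"
  unfolding SSP_def spec_gap_def ..

lemma spec_gapD:
  fixes s p :: nat and a b :: "nat \<Rightarrow> nat"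
  assumes "spec_gap X d f \<epsilon> M" "s \<ge> 1"
    "\<forall>i\<in>{1..s}. x i \<in> X" "\<forall>i\<in>{1..s}. a i \<le> b i" "\<forall>j\<in>{2..s}. b (j - 1) < a j"
    "\<forall>j\<in>{2..s}. int (a j) - int (b (j - 1)) > int M"
    "int p > int M + int (b s) - int (a 1)"
  obtains z where "periodic_point X f p z"
    "\<And>i j. i \<in> {1..s} \<Longrightarrow> j \<in> {a i..b i} \<Longrightarrow> d (iter f j z) (iter f j (x i)) < \<epsilon>"
proof -
  have "\<exists>z. periodic_point X f p z \<and>
      (\<forall>i\<in>{1..s}. \<forall>j\<in>{a i..b i}. d (iter f j z) (iter f j (x i)) < \<epsilon>)"
    using assms(1)[unfolded spec_gap_def, THEN spec, THEN mp, OF assms(2), THEN spec, THEN spec,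
        THEN spec, THEN spec, THEN mp, OF assms(3), THEN mp, OF assms(4), THEN mp, OF assms(5),
        THEN mp, OF assms(6), THEN mp, OF assms(7)] .
  then show thesis
    using that by blast
qed

text \<open>A larger gap only strengthens the demands on the spacing and on the period, so fewer
  specifications remain to be traced.\<close>

lemma spec_gap_mono:
  assumes "spec_gap X d f \<epsilon> M" "M \<le> N"
  shows "spec_gap X d f \<epsilon> N"
  unfolding spec_gap_def
proof (intro allI impI)
  fix s p :: nat and x :: "nat \<Rightarrow> 'a" and a b :: "nat \<Rightarrow> nat"
  assume hyps: "s \<ge> 1" "\<forall>i\<in>{1..s}. x i \<in> X" "\<forall>i\<in>{1..s}. a i \<le> b i"
      "\<forall>j\<in>{2..s}. b (j - 1) < a j"
    and gap: "\<forall>j\<in>{2..s}. int (a j) - int (b (j - 1)) > int N"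
    and period: "int p > int N + int (b s) - int (a 1)"
  have gap': "\<forall>j\<in>{2..s}. int (a j) - int (b (j - 1)) > int M"
    using gap \<open>M \<le> N\<close> by fastforce
  have period': "int p > int M + int (b s) - int (a 1)"
    using period \<open>M \<le> N\<close> by linarith
  show "\<exists>z. periodic_point X f p z \<and>
      (\<forall>i\<in>{1..s}. \<forall>j\<in>{a i..b i}. d (iter f j z) (iter f j (x i)) < \<epsilon>)"
    by (rule spec_gapD[OF assms(1) hyps gap' period']) blast
qed

lemma iter_prod_system: "iter (prod_system f g) n = map_prod (iter f n) (iter g n)"
  by (induction n) (auto simp: prod_system_def map_prod_compose map_prod.id)

text \<open>The admissibility conditions involve only \<open>s\<close>, \<open>a\<close>,
  \<open>b\<close>, \<open>p\<close> and \<open>M\<close>, so one specification in the product is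
  admissible for both coordinates at once.\<close>

lemma spec_gap_prod:
  assumes "spec_gap X d1 f \<epsilon> M" "spec_gap Y d2 g \<epsilon> M"
  shows "spec_gap (X \<times> Y) (max_dist d1 d2) (prod_system f g) \<epsilon> M"
  unfolding spec_gap_def
proof (intro allI impI)
  fix s p :: nat and w :: "nat \<Rightarrow> 'a \<times> 'b" and a b :: "nat \<Rightarrow> nat"
  assume s: "s \<ge> 1" and w: "\<forall>i\<in>{1..s}. w i \<in> X \<times> Y"
    and ab: "\<forall>i\<in>{1..s}. a i \<le> b i" "\<forall>j\<in>{2..s}. b (j - 1) < a j"
      "\<forall>j\<in>{2..s}. int (a j) - int (b (j - 1)) > int M"
      "int p > int M + int (b s) - int (a 1)"
  have w': "\<forall>i\<in>{1..s}. fst (w i) \<in> X" "\<forall>i\<in>{1..s}. snd (w i) \<in> Y"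
    using w by (auto simp: mem_Times_iff)
  obtain u where u: "periodic_point X f p u"
    "\<And>i j. i \<in> {1..s} \<Longrightarrow> j \<in> {a i..b i} \<Longrightarrow> d1 (iter f j u) (iter f j (fst (w i))) < \<epsilon>"
    by (rule spec_gapD[OF assms(1) s w'(1) ab]) blast
  obtain v where v: "periodic_point Y g p v"
    "\<And>i j. i \<in> {1..s} \<Longrightarrow> j \<in> {a i..b i} \<Longrightarrow> d2 (iter g j v) (iter g j (snd (w i))) < \<epsilon>"
    by (rule spec_gapD[OF assms(2) s w'(2) ab]) blast
  \<comment> \<open>Both coordinates were obtained with the same \<open>p\<close>, so no common
    multiple of periods has to be formed.\<close>
  have "periodic_point (X \<times> Y) (prod_system f g) p (u, v)"
    using u(1) v(1) by (simp add: periodic_point_def iter_prod_system)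
  moreover have "max_dist d1 d2 (iter (prod_system f g) j (u, v)) (iter (prod_system f g) j (w i)) < \<epsilon>"
    if "i \<in> {1..s}" "j \<in> {a i..b i}" for i j
    using u(2)[OF that] v(2)[OF that]
    by (cases "w i") (simp add: iter_prod_system max_dist_apply)
  ultimately show "\<exists>z. periodic_point (X \<times> Y) (prod_system f g) p z \<and>
      (\<forall>i\<in>{1..s}. \<forall>j\<in>{a i..b i}. max_dist d1 d2 (iter (prod_system f g) j z)
         (iter (prod_system f g) j (w i)) < \<epsilon>)"
    by blast
qed

lemma SSP_prod:
  assumes "SSP X d1 f" "SSP Y d2 g"
  shows "SSP (X \<times> Y) (max_dist d1 d2) (prod_system f g)"
  unfolding SSP_iff_spec_gap
proof (intro allI impI)
  fix \<epsilon> :: real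
  assume "\<epsilon> > 0"
  then obtain M N where "M > 0" "spec_gap X d1 f \<epsilon> M" "spec_gap Y d2 g \<epsilon> N"
    using assms unfolding SSP_iff_spec_gap by blast
  then show "\<exists>M>0. spec_gap (X \<times> Y) (max_dist d1 d2) (prod_system f g) \<epsilon> M"
    \<comment> \<open>Positivity of \<open>M\<close> alone makes the common gap
      \<open>max M N\<close> positive.\<close>
    by (intro exI[of _ "max M N"])
       (auto intro!: spec_gap_prod intro: spec_gap_mono)
qed

text \<open>Lift the given points through \<open>h\<close>, trace the lifts in \<open>Z\<close>, and
  push the tracing point forward. Since \<open>h\<close> does not increase distances, the gap for
  \<epsilon> in \<open>Z\<close> also serves for \<epsilon> in \<open>X\<close>.\<close>

lemma SSP_factor:
  assumes "SSP Z d k"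
    and onto: "h ` Z = X"
    and semiconj: "\<And>n z. h (iter k n z) = iter f n (h z)"
    and nonexp: "\<And>u v. d' (h u) (h v) \<le> d u v"
  shows "SSP X d' f"
  unfolding SSP_iff_spec_gap
proof (intro allI impI)
  fix \<epsilon> :: real
  assume "\<epsilon> > 0"
  then obtain M where "M > 0" and M: "spec_gap Z d k \<epsilon> M"
    using assms(1) unfolding SSP_iff_spec_gap by blast
  have "spec_gap X d' f \<epsilon> M"
    unfolding spec_gap_def
  proof (intro allI impI)
    fix s p :: nat and x :: "nat \<Rightarrow> 'b" and a b :: "nat \<Rightarrow> nat"
    assume s: "s \<ge> 1" and x: "\<forall>i\<in>{1..s}. x i \<in> X"
      and ab: "\<forall>i\<in>{1..s}. a i \<le> b i" "\<forall>j\<in>{2..s}. b (j - 1) < a j"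
        "\<forall>j\<in>{2..s}. int (a j) - int (b (j - 1)) > int M"
        "int p > int M + int (b s) - int (a 1)"
    \<comment> \<open>Arbitrary preimages suffice: the orbit of \<open>w i\<close> lies over that of
      \<open>x i\<close> by \<open>semiconj\<close>.\<close>
    define w where "w = inv_into Z h \<circ> x"
    have w: "\<forall>i\<in>{1..s}. w i \<in> Z" "\<forall>i\<in>{1..s}. h (w i) = x i"
      using x onto by (auto simp: w_def inv_into_into f_inv_into_f)
    obtain z where z: "periodic_point Z k p z"
      and close: "\<And>i j. i \<in> {1..s} \<Longrightarrow> j \<in> {a i..b i} \<Longrightarrow> d (iter k j z) (iter k j (w i)) < \<epsilon>"
      by (rule spec_gapD[OF M s w(1) ab]) blast
    have "periodic_point X f p (h z)"
      \<comment> \<open>Semiconjugacy read backwards turns \<open>iter f (p * m) (h z)\<close> into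
        \<open>h (iter k (p * m) z)\<close>, which is \<open>h z\<close>.\<close>
      using z onto by (auto simp: periodic_point_def simp flip: semiconj)
    moreover have "d' (iter f j (h z)) (iter f j (x i)) < \<epsilon>"
      if "i \<in> {1..s}" "j \<in> {a i..b i}" for i j
      using le_less_trans[OF nonexp close[OF that]] w(2) that(1) by (simp add: semiconj)
    ultimately show "\<exists>z. periodic_point X f p z \<and>
        (\<forall>i\<in>{1..s}. \<forall>j\<in>{a i..b i}. d' (iter f j z) (iter f j (x i)) < \<epsilon>)"
      by blast
  qed
  with \<open>M > 0\<close> show "\<exists>M>0. spec_gap X d' f \<epsilon> M"
    by blast
qed

theorem theorem3p3:
  fixes X :: "'a set" and Y :: "'b set"
    and d1 :: "'a \<Rightarrow> 'a \<Rightarrow> real" and d2 :: "'b \<Rightarrow> 'b \<Rightarrow> real"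
    and f :: "nat \<Rightarrow> 'a \<Rightarrow> 'a" and g :: "nat \<Rightarrow> 'b \<Rightarrow> 'b"
  assumes "nonautonomous_system X d1 f" and "nonautonomous_system Y d2 g"
  shows "(SSP X d1 f \<and> SSP Y d2 g) \<longleftrightarrow> SSP (X \<times> Y) (max_dist d1 d2) (prod_system f g)"
proof
  assume "SSP X d1 f \<and> SSP Y d2 g"
  then show "SSP (X \<times> Y) (max_dist d1 d2) (prod_system f g)"
    by (simp add: SSP_prod)
next
  assume prod: "SSP (X \<times> Y) (max_dist d1 d2) (prod_system f g)"
  \<comment> \<open>A projection of \<open>X \<times> Y\<close> is onto its factor because the other
    factor has a point.\<close>
  have "X \<noteq> {}" "Y \<noteq> {}"
    using assms by (auto simp: nonautonomous_system_def)
  then have "fst ` (X \<times> Y) = X" "snd ` (X \<times> Y) = Y"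
    by auto
  then show "SSP X d1 f \<and> SSP Y d2 g"
    by (intro conjI SSP_factor[OF prod, of fst] SSP_factor[OF prod, of snd])
       (simp_all add: iter_prod_system max_dist_def case_prod_beta)
qed

end
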